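(* For every singular cardinal $\lambda$ of countable cofinality there is a $(\lambda,\lambda^+)$-graph of type $T_\lambda$ that does not have an $(\aleph_0,\lambda^+)$-subgraph.
   Context: For infinite cardinals $\lambda<\kappa$, a $(\lambda,\kappa)$-graph is a bipartite graph with bipartition $(A,B)$, $|A|=\lambda$, $|B|=\kappa$, in which every $b\in B$ has infinitely many neighbours in $A$. An $(\lambda',\kappa)$-subgraph of it is a subgraph with bipartition $(C,D)$, $C\subseteq A$, $D\subseteq B$, that is itself a $(\lambda',\kappa)$-graph. For a cardinal $\lambda$, $T_\lambda$ is the order tree of all sequences of elements of $\lambda$ of length at most $\omega$ (including the empty sequence), ordered by initial segment; $T_\lambda^{<\omega}$ consists of the finite sequences and $T_\lambda^\omega$ of the $\omega$-sequences. For $\kappa>\lambda$, the down-closure $T$ of a $\kappa$-sized set $X\subseteq T_\lambda^\omega$ is a $\lambda$-tree with $\kappa$ tops (the tops being the elements of $X$). A $T$-graph is a graph with vertex set $T$ in which the endvertices of every edge are comparable and for every $t$ the neighbours of $t$ below $t$ are cofinal in $\{s : s<t\}$. A $(\lambda,\kappa)$-graph of type $T_\lambda$ is the bipartite graph with bipartition classes $T^{<\omega}$ and $X$ formed by the edges between these sets of some $T$-graph, where $T$ is a $\lambda$-tree with $\kappa$ tops $X$. *)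

theory Defs
  imports Main "HOL-Library.Countable_Set"
begin

unbundle cardinal_syntax

text \<open>Vertices of the tree T_lambda: finite sequences (Inl) and omega-sequences (Inr)
  of elements of a set L (playing the role of the cardinal lambda).\<close>
type_synonym 'a tnode = "'a list + (nat \<Rightarrow> 'a)"

definition in_T :: "'a set \<Rightarrow> 'a tnode \<Rightarrow> bool" where
  "in_T L t = (case t of Inl xs \<Rightarrow> set xs \<subseteq> L | Inr f \<Rightarrow> range f \<subseteq> L)"

definition tless :: "'a tnode \<Rightarrow> 'a tnode \<Rightarrow> bool" where
  "tless s t = (case (s, t) of
      (Inl xs, Inl ys) \<Rightarrow> length xs < length ys \<and> xs = take (length xs) ys
    | (Inl xs, Inr f) \<Rightarrow> xs = map f [0..<length xs]
    | (Inr _, _) \<Rightarrow> False)"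

definition comparable :: "'a tnode \<Rightarrow> 'a tnode \<Rightarrow> bool" where
  "comparable s t = (s = t \<or> tless s t \<or> tless t s)"

definition down_closure :: "(nat \<Rightarrow> 'a) set \<Rightarrow> 'a tnode set" where
  "down_closure X = Inr ` X \<union> {Inl (map f [0..<n]) | f n. f \<in> X}"

definition tree_with_tops :: "'a set \<Rightarrow> 'b rel \<Rightarrow> (nat \<Rightarrow> 'a) set \<Rightarrow> 'a tnode set \<Rightarrow> bool" where
  "tree_with_tops L kap X T =
     ((\<forall>f\<in>X. range f \<subseteq> L) \<and> |X| =o kap \<and> T = down_closure X)"

definition T_graph :: "'a tnode set \<Rightarrow> ('a tnode \<times> 'a tnode) set \<Rightarrow> bool" where
  "T_graph T E =
     (E \<subseteq> T \<times> T \<and> sym E \<and> (\<forall>(s,t)\<in>E. s \<noteq> t \<and> comparable s t) \<and>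
      (\<forall>t\<in>T. \<forall>s\<in>T. tless s t \<longrightarrow>
           (\<exists>u\<in>T. (s = u \<or> tless s u) \<and> tless u t \<and> (u,t) \<in> E)))"

definition lk_graph :: "'c rel \<Rightarrow> 'd rel \<Rightarrow> 'v set \<Rightarrow> 'w set \<Rightarrow> ('v \<times> 'w) set \<Rightarrow> bool" where
  "lk_graph lam kap A B E =
     (E \<subseteq> A \<times> B \<and> |A| =o lam \<and> |B| =o kap \<and>
      (\<forall>b\<in>B. infinite {a\<in>A. (a,b) \<in> E}))"

definition has_subgraph :: "'c rel \<Rightarrow> 'd rel \<Rightarrow> 'v set \<Rightarrow> 'w set \<Rightarrow> ('v \<times> 'w) set \<Rightarrow> bool" where
  "has_subgraph lam' kap A B E =
     (\<exists>C D F. C \<subseteq> A \<and> D \<subseteq> B \<and> F \<subseteq> E \<and> lk_graph lam' kap C D F)"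

definition type_T_graph :: "'a set \<Rightarrow> 'b rel \<Rightarrow> 'a list set \<Rightarrow> (nat \<Rightarrow> 'a) set \<Rightarrow> ('a list \<times> (nat \<Rightarrow> 'a)) set \<Rightarrow> bool" where
  "type_T_graph L kap A B H =
     (\<exists>X T E. tree_with_tops L kap X T \<and> T_graph T E \<and>
        A = {xs. Inl xs \<in> T} \<and> B = X \<and>
        H = {(xs, f). (Inl xs, Inr f) \<in> E})"

end

theory Submission
  imports Defs "HOL-Library.Countable_Set_Type"
begin

text \<open>Taking all comparable pairs as edges, it suffices to find \<open>\<lambda>\<^sup>+\<close> sequences in \<open>\<lambda>\<close> such that every countable
  subset of \<open>\<lambda>\<close> contains the ranges of at most \<open>\<lambda>\<close> of them. Write \<open>\<lambda>\<close> as an increasing union of sets \<open>A\<^sub>n\<close> of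
  smaller size. For \<open>d < \<lambda>\<^sup>+\<close> cover the predecessors of \<open>d\<close> by an increasing sequence of closed sets \<open>B d n\<close>
  of size at most \<open>|A\<^sub>n|\<close>, and choose \<open>f d n < |A\<^sub>n|\<^sup>+\<close> recursively above all \<open>f x n\<close> with \<open>x \<in> B d n\<close>.
  Club guessing on \<open>\<omega>\<^sub>3\<close> shows that every unbounded subset of \<open>\<lambda>\<^sup>+\<close> has an uncountable subset on which some
  coordinate of \<open>f\<close> is strictly increasing. Hence in every subfamily of size \<open>\<lambda>\<^sup>+\<close> some coordinate takes
  uncountably many values.\<close>

section \<open>Cardinality bounds\<close>

lemma card_of_ordLess_iff_not_ordLeq: "|A| <o |B| \<longleftrightarrow> \<not> |B| \<le>o |A|"
  using not_ordLeq_iff_ordLess[OF card_of_Well_order card_of_Well_order] by blast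

lemma card_of_countable_ordLeq: "countable A \<Longrightarrow> infinite B \<Longrightarrow> |A| \<le>o |B|"
  unfolding countable_card_of_nat infinite_iff_card_of_nat by (rule ordLeq_transitive)

lemma card_of_subset_ordLeq: "A \<subseteq> B \<Longrightarrow> |B| \<le>o r \<Longrightarrow> |A| \<le>o r"
  using card_of_mono1 by (rule ordLeq_transitive)

lemma card_of_image_ordLeq: "|A| \<le>o r \<Longrightarrow> |f ` A| \<le>o r"
  using card_of_image by (rule ordLeq_transitive)

lemma card_of_Un_ordLeq_infinite:
  assumes "infinite C" "|A| \<le>o |C|" "|B| \<le>o |C|"
  shows "|A \<union> B| \<le>o |C|"
  using assms by (intro card_of_Un_ordLeq_infinite_Field card_of_Card_order) (auto simp: Field_card_of)

lemma card_of_insert_ordLeq_infinite: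
  assumes "infinite B" "|A| \<le>o |B|"
  shows "|insert x A| \<le>o |B|"
  using card_of_Un_ordLeq_infinite[OF assms(1) card_of_countable_ordLeq[OF _ assms(1)] assms(2), of "{x}"]
  by simp

lemma card_of_finite_UN_ordLess:
  fixes A :: "'i \<Rightarrow> 'a set"
  assumes "infinite C" "finite I" "\<And>i. i \<in> I \<Longrightarrow> |A i| <o |C|"
  shows "|\<Union>i\<in>I. A i| <o |C|"
  using assms(2,3)
proof (induction I rule: finite_induct)
  case empty
  have "\<not> |C| \<le>o |{} :: 'a set|"
    using assms(1) card_of_ordLeq_finite by blast
  then show ?case
    by (simp add: card_of_ordLess_iff_not_ordLeq)
next
  case (insert i I)
  then show ?case
    using card_of_Un_ordLess_infinite[OF assms(1), of "A i" "\<Union>i\<in>I. A i"] by simp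
qed

lemma card_of_lists_ordLeq_infinite:
  assumes "infinite L"
  shows "|lists L| \<le>o |L|"
proof -
  have level: "|{xs \<in> lists L. length xs = n}| \<le>o |L|" for n
  proof (induction n)
    case 0
    have "{xs \<in> lists L. length xs = 0} = {[]}"
      by auto
    then show ?case
      using card_of_countable_ordLeq[OF _ assms, of "{[]}"] by simp
  next
    case (Suc n)
    let ?T = "L \<times> {xs \<in> lists L. length xs = n}"
    have "|?T| \<le>o |L|"
      using Suc assms by (intro card_of_Times_ordLeq_infinite_Field card_of_Card_order)
        (simp_all add: Field_card_of card_of_mono1)
    moreover have "{xs \<in> lists L. length xs = Suc n} \<subseteq> (\<lambda>(x, xs). x # xs) ` ?T"
      by (auto simp: length_Suc_conv image_iff)
    ultimately show ?case
      using card_of_subset_ordLeq[OF _ card_of_image_ordLeq] by blast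
  qed
  have "|\<Union>n. {xs \<in> lists L. length xs = n}| \<le>o |L|"
    using assms level by (intro card_of_UNION_ordLeq_infinite card_of_countable_ordLeq) auto
  moreover have "lists L \<subseteq> (\<Union>n. {xs \<in> lists L. length xs = n})"
    by auto
  ultimately show ?thesis
    using card_of_subset_ordLeq by blast
qed

lemma ex_large_fibre:
  fixes k :: "'b \<Rightarrow> nat"
  assumes "infinite M" "|M| <o |U|"
  shows "\<exists>n. |M| <o |{u \<in> U. k u = n}|"
proof (rule ccontr)
  assume "\<not> ?thesis"
  then have "|{u \<in> U. k u = n}| \<le>o |M|" for n
    by (simp add: card_of_ordLess_iff_not_ordLeq)
  then have "|\<Union>n. {u \<in> U. k u = n}| \<le>o |M|"
    using assms(1) by (intro card_of_UNION_ordLeq_infinite card_of_countable_ordLeq) auto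
  moreover have "(\<Union>n. {u \<in> U. k u = n}) = U"
    by blast
  ultimately show False
    using assms(2) not_ordLess_ordLeq by auto
qed

section \<open>Well-orders\<close>

lemma wellorder_dependent_choice:
  fixes P :: "('t :: wellorder \<Rightarrow> 'b) \<Rightarrow> 't \<Rightarrow> 'b \<Rightarrow> bool"
  assumes "\<And>f g i r. (\<And>j. j < i \<Longrightarrow> f j = g j) \<Longrightarrow> P f i r = P g i r"
    and "\<And>f i. (\<And>j. j < i \<Longrightarrow> P f j (f j)) \<Longrightarrow> \<exists>r. P f i r"
  shows "\<exists>f. \<forall>i. P f i (f i)"
proof (rule dependent_wf_choice[OF wf])
  show "P f i r = P g i r" if "\<And>j. (j, i) \<in> {(x, y). x < y} \<Longrightarrow> f j = g j" for f g i r
    using that by (intro assms(1)) simp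
  show "\<exists>r. P f i r" if "\<And>j. (j, i) \<in> {(x, y). x < y} \<Longrightarrow> P f j (f j)" for f i
    using that by (intro assms(2)) simp
qed

text \<open>Junk if \<open>Z\<close> is unbounded.\<close>
definition lub :: "'t :: wellorder set \<Rightarrow> 't" where
  "lub Z = (LEAST b. \<forall>z\<in>Z. z \<le> b)"

lemma lub_upper:
  assumes "bdd_above Z" "z \<in> Z"
  shows "z \<le> lub Z"
proof -
  have "\<forall>z\<in>Z. z \<le> lub Z"
    unfolding lub_def by (rule LeastI_ex) (use assms(1) in \<open>simp add: bdd_above_def\<close>)
  then show ?thesis
    using assms(2) by blast
qed

lemma lub_least: "(\<And>z. z \<in> Z \<Longrightarrow> z \<le> b) \<Longrightarrow> lub Z \<le> b"
  unfolding lub_def by (rule Least_le) blast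

lemma lub_mono: "Y \<subseteq> Z \<Longrightarrow> bdd_above Z \<Longrightarrow> lub Y \<le> lub Z"
  by (intro lub_least lub_upper) auto

lemma less_lubD: "y < lub Z \<Longrightarrow> \<exists>z\<in>Z. y < z"
  using not_less_Least[of y "\<lambda>b. \<forall>z\<in>Z. z \<le> b"] unfolding lub_def by (auto simp: not_le)

definition sup_before :: "('i :: wellorder \<Rightarrow> 't :: wellorder) \<Rightarrow> 'i \<Rightarrow> 't" where
  "sup_before y i = lub (y ` {..<i})"

lemma sup_before_cong: "(\<And>j. j < i \<Longrightarrow> y j = y' j) \<Longrightarrow> sup_before y i = sup_before y' i"
  by (simp add: sup_before_def cong: image_cong_simp)

definition next_in :: "'t :: wellorder set \<Rightarrow> 't \<Rightarrow> 't" where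
  "next_in A x = (LEAST a. a \<in> A \<and> x < a)"

lemma next_in:
  assumes "\<exists>a\<in>A. x < a"
  shows next_in_mem: "next_in A x \<in> A" and less_next_in: "x < next_in A x"
  using assms LeastI_ex[of "\<lambda>a. a \<in> A \<and> x < a"] unfolding next_in_def by blast+

lemma next_in_le: "a \<in> A \<Longrightarrow> x < a \<Longrightarrow> next_in A x \<le> a"
  unfolding next_in_def by (rule Least_le) simp

definition nonlast :: "'t :: order set \<Rightarrow> 't set" where
  "nonlast A = {x \<in> A. \<exists>a\<in>A. x < a}"

lemma subset_insert_nonlast:
  fixes A :: "'t :: linorder set"
  shows "\<exists>z. A \<subseteq> insert z (nonlast A)"
proof (cases "A \<subseteq> nonlast A")
  case False
  then obtain z where "z \<in> A" "z \<notin> nonlast A"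
    by blast
  then have "A \<subseteq> insert z (nonlast A)"
    unfolding nonlast_def by (auto simp: not_less dest: le_neq_trans)
  then show ?thesis ..
qed blast

lemma card_of_ordLeq_nonlast:
  fixes A :: "'t :: linorder set"
  assumes "infinite M" "|nonlast A| \<le>o |M|"
  shows "|A| \<le>o |M|"
proof -
  obtain z where "A \<subseteq> insert z (nonlast A)"
    using subset_insert_nonlast by blast
  then show ?thesis
    using card_of_insert_ordLeq_infinite[OF assms] by (rule card_of_subset_ordLeq)
qed

definition order_closure :: "'t :: wellorder set \<Rightarrow> 't set" where
  "order_closure A = {x. \<forall>y<x. \<exists>a\<in>A. y < a \<and> a \<le> x}"

lemma subset_order_closure: "A \<subseteq> order_closure A"
  unfolding order_closure_def by blast

lemma order_closure_mono: "A \<subseteq> A' \<Longrightarrow> order_closure A \<subseteq> order_closure A'"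
  unfolding order_closure_def by blast

lemma order_closure_idem: "order_closure (order_closure A) \<subseteq> order_closure A"
proof
  fix x assume x: "x \<in> order_closure (order_closure A)"
  show "x \<in> order_closure A"
    unfolding order_closure_def
  proof safe
    fix y assume "y < x"
    then obtain b where "b \<in> order_closure A" "y < b" "b \<le> x"
      using x unfolding order_closure_def[of "order_closure A"] by blast
    moreover from this obtain a where "a \<in> A" "y < a" "a \<le> b"
      unfolding order_closure_def by blast
    ultimately show "\<exists>a\<in>A. y < a \<and> a \<le> x"
      by (meson order_trans)
  qed
qed

lemma lub_mem_order_closure:
  assumes "bdd_above Z" "Z \<subseteq> A"
  shows "lub Z \<in> order_closure A"
  using less_lubD lub_upper[OF assms(1)] assms(2) unfolding order_closure_def by blast

text \<open>Two points of the closure are separated by a point of \<open>A\<close>, so \<open>next_in A\<close> is injective on the closure,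
  except possibly for its last point.\<close>
lemma card_of_order_closure:
  assumes "infinite B" "|A| \<le>o |B|"
  shows "|order_closure A| \<le>o |B|"
proof -
  define C where "C = order_closure A"
  have between: "\<exists>a\<in>A. x < a \<and> a \<le> x'" if "x < x'" "x' \<in> C" for x x'
    using that unfolding C_def order_closure_def by blast
  have ex_next: "\<exists>a\<in>A. x < a" if "x \<in> nonlast C" for x
    using that between unfolding nonlast_def by blast
  have "next_in A x < next_in A x'" if less: "x < x'" and x': "x' \<in> nonlast C" for x x'
  proof -
    obtain a where "a \<in> A" "x < a" "a \<le> x'"
      using between[OF less] x' unfolding nonlast_def by blast
    then have "next_in A x \<le> x'"
      by (meson next_in_le order_trans)
    also have "\<dots> < next_in A x'"
      using ex_next[OF x'] by (rule less_next_in)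
    finally show ?thesis .
  qed
  then have "inj_on (next_in A) (nonlast C)"
    by (rule strict_mono_on_imp_inj_on[OF strict_mono_onI])
  then have "|nonlast C| \<le>o |A|"
    by (rule card_of_ordLeqI) (rule next_in_mem[OF ex_next])
  then have "|nonlast C| \<le>o |B|"
    using assms(2) by (rule ordLeq_transitive)
  then show ?thesis
    unfolding C_def by (rule card_of_ordLeq_nonlast[OF assms(1)])
qed

section \<open>Successor cardinals as well-ordered types\<close>

lemma card_of_Field_cardSuc: "|Field (cardSuc |A| )| =o cardSuc |A|"
  by (intro card_of_Field_ordIso cardSuc_Card_order card_of_Card_order)

lemma card_of_ordLess_cardSuc: "|A| <o cardSuc |A|"
  by (rule cardSuc_greater[OF card_of_Card_order])

text \<open>Made a type so that it can be an instance of class \<open>wellorder\<close>.\<close>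
typedef 'a csuc = "Field (cardSuc |UNIV :: 'a set| )"
proof -
  have "|UNIV :: 'a set| <o |Field (cardSuc |UNIV :: 'a set| )|"
    by (rule ordLess_ordIso_trans[OF card_of_ordLess_cardSuc ordIso_symmetric[OF card_of_Field_cardSuc]])
  then have "Field (cardSuc |UNIV :: 'a set| ) \<noteq> {}"
    using card_of_empty not_ordLess_ordLeq by metis
  then show ?thesis
    by blast
qed

lemma well_order_on_cardSuc: "well_order_on (Field (cardSuc |A| )) (cardSuc |A| )"
  by (intro cardSuc_Well_order card_of_Card_order)

instantiation csuc :: (type) wellorder
begin

definition less_eq_csuc :: "'a csuc \<Rightarrow> 'a csuc \<Rightarrow> bool" where
  "x \<le> y \<longleftrightarrow> (Rep_csuc x, Rep_csuc y) \<in> cardSuc |UNIV :: 'a set|"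

definition less_csuc :: "'a csuc \<Rightarrow> 'a csuc \<Rightarrow> bool" where
  "x < y \<longleftrightarrow> x \<le> y \<and> x \<noteq> (y :: 'a csuc)"

instance
proof
  note wo = well_order_on_cardSuc[of "UNIV :: 'a set",
      unfolded well_order_on_def linear_order_on_def partial_order_on_def preorder_on_def]
  fix x y z :: "'a csuc"
  show "x \<le> x"
    using wo Rep_csuc[of x] by (auto simp: less_eq_csuc_def refl_on_def)
  show antisym: "x \<le> y \<Longrightarrow> y \<le> x \<Longrightarrow> x = y"
    using wo unfolding less_eq_csuc_def antisym_def by (metis Rep_csuc_inject)
  show "x < y \<longleftrightarrow> x \<le> y \<and> \<not> y \<le> x"
    using wo \<open>x \<le> x\<close> unfolding less_csuc_def less_eq_csuc_def antisym_def by (metis Rep_csuc_inject)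
  show "x \<le> y \<Longrightarrow> y \<le> z \<Longrightarrow> x \<le> z"
    using wo unfolding less_eq_csuc_def trans_def by blast
  show "x \<le> y \<or> y \<le> x"
    using wo Rep_csuc[of x] Rep_csuc[of y] unfolding less_eq_csuc_def total_on_def refl_on_def
    by metis
  have wf: "wf (inv_image (cardSuc |UNIV :: 'a set| - Id) Rep_csuc)"
    using wo by simp
  fix P :: "'a csuc \<Rightarrow> bool" and a
  assume step: "\<And>x. (\<And>y. y < x \<Longrightarrow> P y) \<Longrightarrow> P x"
  show "P a"
    using wf
  proof (induction a rule: wf_induct_rule)
    case (less x)
    show ?case
      by (rule step, rule less) (auto simp: less_csuc_def less_eq_csuc_def inv_image_def Rep_csuc_inject)
  qed
qed

end

lemma card_of_UNIV_csuc: "|UNIV :: 'a csuc set| =o cardSuc |UNIV :: 'a set|"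
proof -
  have "bij_betw Rep_csuc UNIV (Field (cardSuc |UNIV :: 'a set| ))"
    by (metis Rep_csuc_inject bij_betw_def inj_onI type_definition.Rep_range type_definition_csuc)
  then show ?thesis
    by (rule ordIso_transitive[OF card_of_ordIsoI card_of_Field_cardSuc])
qed

lemma card_of_UNIV_ordLess_csuc: "|UNIV :: 'a set| <o |UNIV :: 'a csuc set|"
  by (rule ordLess_ordIso_trans[OF card_of_ordLess_cardSuc ordIso_symmetric[OF card_of_UNIV_csuc]])

lemma infinite_UNIV_csuc: "infinite (UNIV :: 'a set) \<Longrightarrow> infinite (UNIV :: 'a csuc set)"
  using card_of_ordLeq_finite[OF ordLess_imp_ordLeq[OF card_of_UNIV_ordLess_csuc]] by blast

lemma card_of_lessThan_csuc: "|{..<x :: 'a csuc}| \<le>o |UNIV :: 'a set|"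
proof -
  let ?r = "cardSuc |UNIV :: 'a set|"
  have "|{..<x}| =o |Rep_csuc ` {..<x}|"
    by (meson Rep_csuc_inject bij_betw_imageI card_of_ordIsoI inj_onI)
  also have "|Rep_csuc ` {..<x}| \<le>o |underS ?r (Rep_csuc x)|"
    by (rule card_of_mono1) (auto simp: underS_def less_csuc_def less_eq_csuc_def Rep_csuc_inject)
  also have "|underS ?r (Rep_csuc x)| <o ?r"
    by (rule card_of_underS) (simp_all only: cardSuc_Card_order card_of_Card_order Rep_csuc)
  finally show ?thesis
    by (metis card_of_Card_order cardSuc_ordLeq_ordLess)
qed

text \<open>A copy of the successor cardinal of \<open>A\<close> as an initial segment of \<open>'a csuc\<close>.\<close>
definition below :: "'a set \<Rightarrow> 'a csuc set" where
  "below A = {x. |{..<x}| \<le>o |A|}"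

lemma below_UNIV: "below (UNIV :: 'a set) = UNIV"
  by (simp add: below_def card_of_lessThan_csuc)

lemma below_downward: "x \<in> below A \<Longrightarrow> y \<le> x \<Longrightarrow> y \<in> below A"
  unfolding below_def using card_of_subset_ordLeq[of "{..<y}" "{..<x}"] by auto

lemma card_of_atMost_below:
  assumes "infinite A" "x \<in> below A"
  shows "|{..x}| \<le>o |A|"
proof -
  have "{..x} = insert x {..<x}"
    by auto
  then show ?thesis
    using assms by (simp add: below_def card_of_insert_ordLeq_infinite)
qed

lemma below_bounded:
  assumes "infinite A" "Z \<subseteq> below A" "|Z| \<le>o |A|"
  shows "\<exists>b\<in>below A. \<forall>z\<in>Z. z < b"
proof -
  define U where "U = (\<Union>z\<in>Z. {..z})"
  have card_U: "|U| \<le>o |A|"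
    unfolding U_def using assms card_of_atMost_below[OF assms(1)]
    by (intro card_of_UNION_ordLeq_infinite) auto
  have "|U| <o |UNIV :: 'a csuc set|"
    using ordLeq_transitive[OF card_U card_of_mono1[OF subset_UNIV]] card_of_UNIV_ordLess_csuc
    by (rule ordLeq_ordLess_trans)
  then have "U \<noteq> UNIV"
    using ordLess_irreflexive by blast
  define b where "b = (LEAST b. b \<notin> U)"
  have "b \<notin> U"
    using \<open>U \<noteq> UNIV\<close> unfolding b_def by (metis LeastI UNIV_eq_I)
  then have "\<forall>z\<in>Z. z < b"
    by (auto simp: U_def not_le)
  moreover have "{..<b} \<subseteq> U"
    unfolding b_def using not_less_Least by auto
  then have "b \<in> below A"
    using card_of_subset_ordLeq[OF _ card_U] unfolding below_def by blast
  ultimately show ?thesis by blast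
qed

lemma csuc_bounded:
  fixes Z :: "'a csuc set"
  assumes "infinite (UNIV :: 'a set)" "|Z| \<le>o |UNIV :: 'a set|"
  shows "\<exists>b. \<forall>z\<in>Z. z < b"
  using below_bounded[of "UNIV :: 'a set" Z] assms by (auto simp: below_UNIV)

lemma csuc_bdd_above:
  fixes Z :: "'a csuc set"
  assumes "infinite (UNIV :: 'a set)" "|Z| \<le>o |UNIV :: 'a set|"
  shows "bdd_above Z"
  using csuc_bounded[OF assms] unfolding bdd_above_def by (auto intro: less_imp_le)

lemma ex_greater_csuc: "infinite (UNIV :: 'a set) \<Longrightarrow> \<exists>y. (x :: 'a csuc) < y"
  using csuc_bounded[of "{x}"] by (simp add: card_of_countable_ordLeq)

lemma ex_greater_of_card_ordLess:
  assumes "infinite A" "x \<in> below A" "|A| <o |Y|"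
  shows "\<exists>y\<in>Y. x < y"
proof (rule ccontr)
  assume "\<not> (\<exists>y\<in>Y. x < y)"
  then have "Y \<subseteq> {..x}"
    by (auto simp: not_less)
  then have "|Y| \<le>o |A|"
    using card_of_atMost_below[OF assms(1,2)] by (rule card_of_subset_ordLeq)
  then show False
    using assms(3) not_ordLess_ordLeq by blast
qed

lemma card_of_below:
  assumes "infinite A"
  shows "|below A| =o cardSuc |A|"
proof -
  let ?k = "cardSuc |A|"
  have "|A| <o |below A|"
    using below_bounded[OF assms subset_refl] by (auto simp: card_of_ordLess_iff_not_ordLeq)
  then have ge: "?k \<le>o |below A|"
    by (intro cardSuc_least card_of_Card_order)
  then have "|Field ?k| \<le>o |below A|"
    by (rule ordIso_ordLeq_trans[OF card_of_Field_cardSuc])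
  then obtain Z where Z: "Z \<subseteq> below A" and "|Field ?k| =o |Z|"
    using iffD1[OF internalize_card_of_ordLeq2] by blast
  then have card_Z: "|Z| =o ?k"
    using ordIso_transitive[OF ordIso_symmetric card_of_Field_cardSuc] by blast
  have A_less_Z: "|A| <o |Z|"
    using card_of_ordLess_cardSuc ordIso_symmetric[OF card_Z] by (rule ordLess_ordIso_trans)
  have "below A \<subseteq> (\<Union>z\<in>Z. {..z})"
    using ex_greater_of_card_ordLess[OF assms _ A_less_Z] by (auto intro: less_imp_le)
  moreover have "|\<Union>z\<in>Z. {..z}| \<le>o |Z|"
  proof (rule card_of_UNION_ordLeq_infinite)
    show "infinite Z"
      using assms card_of_ordLeq_finite ordLess_imp_ordLeq[OF A_less_Z] by blast
    show "\<forall>z\<in>Z. |{..z}| \<le>o |Z|"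
      using card_of_atMost_below[OF assms] Z ordLeq_transitive[OF _ ordLess_imp_ordLeq[OF A_less_Z]] by blast
  qed (simp only: ordLeq_refl card_of_Card_order)
  ultimately have "|below A| \<le>o |Z|"
    by (rule card_of_subset_ordLeq)
  then have "|below A| \<le>o ?k"
    using card_Z by (rule ordLeq_ordIso_trans)
  then show ?thesis
    using ge by (simp add: ordIso_iff_ordLeq)
qed

section \<open>Club guessing\<close>

text \<open>As \<open>order_closure E\<close> contains the least element of the type, so does every club.\<close>
definition club :: "'t :: wellorder set \<Rightarrow> bool" where
  "club E \<longleftrightarrow> (\<forall>x. \<exists>e\<in>E. x < e) \<and> order_closure E \<subseteq> E"

lemma club_unbounded: "club E \<Longrightarrow> \<exists>e\<in>E. x < e"
  unfolding club_def by blast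

lemma club_closed: "club E \<Longrightarrow> order_closure E \<subseteq> E"
  unfolding club_def by blast

lemma lub_interleaved_mem_order_closure:
  fixes s :: "nat \<Rightarrow> 't :: wellorder"
  assumes "bdd_above (range s)" "\<And>n. \<exists>e\<in>E. s n < e \<and> e \<le> s (Suc n)"
  shows "lub (range s) \<in> order_closure E"
  unfolding order_closure_def
proof safe
  fix y assume "y < lub (range s)"
  then obtain n where "y < s n"
    using less_lubD by blast
  moreover obtain e where "e \<in> E" "s n < e" "e \<le> s (Suc n)"
    using assms(2) by blast
  moreover have "s (Suc n) \<le> lub (range s)"
    by (rule lub_upper[OF assms(1)]) simp
  ultimately show "\<exists>e\<in>E. y < e \<and> e \<le> lub (range s)"
    by (meson less_trans order_trans)
qed

lemma clubs_common_bound: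
  fixes E :: "'i \<Rightarrow> 'u csuc set"
  assumes inf: "infinite (UNIV :: 'u set)" and card_I: "|I| \<le>o |UNIV :: 'u set|"
    and club: "\<And>i. i \<in> I \<Longrightarrow> club (E i)"
  shows "\<exists>b>y. \<forall>i\<in>I. \<exists>e\<in>E i. y < e \<and> e \<le> b"
proof -
  have "\<exists>e. e \<in> E i \<and> y < e" if "i \<in> I" for i
    using club_unbounded[OF club[OF that]] by blast
  then obtain e where e: "\<And>i. i \<in> I \<Longrightarrow> e i \<in> E i \<and> y < e i"
    by metis
  have "|insert y (e ` I)| \<le>o |UNIV :: 'u set|"
    by (rule card_of_insert_ordLeq_infinite[OF inf card_of_image_ordLeq[OF card_I]])
  then obtain b where "\<forall>z\<in>insert y (e ` I). z < b"
    using csuc_bounded[OF inf] by blast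
  then have "y < b" "\<forall>i\<in>I. e i \<le> b"
    by (simp_all add: less_imp_le)
  then show ?thesis
    using e by blast
qed

lemma clubs_common_element:
  fixes E :: "'i \<Rightarrow> 'u csuc set"
  assumes inf: "infinite (UNIV :: 'u set)" and card_I: "|I| \<le>o |UNIV :: 'u set|"
    and club: "\<And>i. i \<in> I \<Longrightarrow> club (E i)"
  shows "\<exists>e\<in>\<Inter>i\<in>I. E i. x < e"
proof -
  have "\<exists>b>y. \<forall>i\<in>I. \<exists>e\<in>E i. y < e \<and> e \<le> b" for y
    by (rule clubs_common_bound[OF assms])
  then obtain nx where nx: "\<And>y. y < nx y" "\<And>y i. i \<in> I \<Longrightarrow> \<exists>e\<in>E i. y < e \<and> e \<le> nx y"
    by metis
  define s where "s n = (nx ^^ n) x" for n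
  have s_Suc: "s (Suc n) = nx (s n)" for n
    by (simp add: s_def)
  have bdd: "bdd_above (range s)"
    by (intro csuc_bdd_above inf card_of_countable_ordLeq) simp_all
  have "lub (range s) \<in> E i" if "i \<in> I" for i
  proof -
    have "lub (range s) \<in> order_closure (E i)"
      using nx(2)[OF that] by (intro lub_interleaved_mem_order_closure[OF bdd]) (simp add: s_Suc)
    then show ?thesis
      using club_closed[OF club[OF that]] by blast
  qed
  moreover have "x < lub (range s)"
  proof -
    have "x < s 1"
      using nx(1) by (simp add: s_def)
    also have "s 1 \<le> lub (range s)"
      by (rule lub_upper[OF bdd]) simp
    finally show ?thesis .
  qed
  ultimately show ?thesis
    by blast
qed

lemma club_INT:
  fixes E :: "'i \<Rightarrow> 'u csuc set"
  assumes "infinite (UNIV :: 'u set)" "|I| \<le>o |UNIV :: 'u set|" and club: "\<And>i. i \<in> I \<Longrightarrow> club (E i)"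
  shows "club (\<Inter>i\<in>I. E i)"
  unfolding club_def
proof (intro conjI allI)
  show "\<exists>e\<in>\<Inter>i\<in>I. E i. x < e" for x
    by (rule clubs_common_element[OF assms])
  show "order_closure (\<Inter>i\<in>I. E i) \<subseteq> (\<Inter>i\<in>I. E i)"
  proof (rule INT_greatest)
    fix i assume i: "i \<in> I"
    have "order_closure (\<Inter>i\<in>I. E i) \<subseteq> order_closure (E i)"
      by (rule order_closure_mono[OF INT_lower[OF i]])
    also have "\<dots> \<subseteq> E i"
      by (rule club_closed[OF club[OF i]])
    finally show "order_closure (\<Inter>i\<in>I. E i) \<subseteq> E i" .
  qed
qed

lemma club_Int:
  fixes E E' :: "'u csuc set"
  assumes "infinite (UNIV :: 'u set)" "club E" "club E'"
  shows "club (E \<inter> E')"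
proof -
  have "club (\<Inter>X\<in>{E, E'}. X)"
    by (rule club_INT[OF assms(1) card_of_countable_ordLeq[OF _ assms(1)]]) (use assms(2,3) in auto)
  then show ?thesis
    by simp
qed

definition drop_to :: "'t :: wellorder set \<Rightarrow> 't \<Rightarrow> 't" where
  "drop_to E x = lub (E \<inter> {..x})"

lemma drop_to_le: "drop_to E x \<le> x"
  unfolding drop_to_def by (rule lub_least) simp

lemma drop_to_greatest: "e \<in> E \<Longrightarrow> e \<le> x \<Longrightarrow> e \<le> drop_to E x"
  unfolding drop_to_def by (rule lub_upper) auto

lemma drop_to_mono: "E \<subseteq> E' \<Longrightarrow> drop_to E x \<le> drop_to E' x"
  unfolding drop_to_def by (rule lub_mono) auto

lemma drop_to_mem: "club E \<Longrightarrow> drop_to E x \<in> E"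
  using club_closed lub_mem_order_closure[of "E \<inter> {..x}" E] unfolding drop_to_def by auto

text \<open>For each \<open>x\<close> the values \<open>drop_to (G i) x\<close> decrease in a well-order, hence stabilise.\<close>
lemma drop_to_stabilises:
  fixes G :: "'k csuc \<Rightarrow> 't :: wellorder set"
  assumes inf: "infinite (UNIV :: 'k set)" and card_c: "|c| \<le>o |UNIV :: 'k set|"
    and anti: "antimono G"
  shows "\<exists>i. \<forall>j\<ge>i. \<forall>x\<in>c. drop_to (G j) x = drop_to (G i) x"
proof -
  have "\<exists>i. \<forall>j\<ge>i. drop_to (G j) x = drop_to (G i) x" for x
  proof -
    define v where "v = (LEAST v. v \<in> range (\<lambda>i. drop_to (G i) x))"
    have "v \<in> range (\<lambda>i. drop_to (G i) x)"
      unfolding v_def by (rule LeastI_ex) blast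
    then obtain i where i: "v = drop_to (G i) x"
      by blast
    have "drop_to (G j) x = drop_to (G i) x" if "i \<le> j" for j
    proof (rule antisym)
      show "drop_to (G j) x \<le> drop_to (G i) x"
        by (rule drop_to_mono[OF antimonoD[OF anti that]])
      show "drop_to (G i) x \<le> drop_to (G j) x"
        unfolding i[symmetric] v_def by (rule Least_le) blast
    qed
    then show ?thesis
      by blast
  qed
  then obtain s where s: "\<And>x j. s x \<le> j \<Longrightarrow> drop_to (G j) x = drop_to (G (s x)) x"
    by metis
  obtain i where "\<forall>y\<in>s ` c. y < i"
    using csuc_bounded[OF inf card_of_image_ordLeq[OF card_c]] by blast
  then have s_le: "s x \<le> i" if "x \<in> c" for x
    using that by (simp add: less_imp_le)
  have "drop_to (G j) x = drop_to (G i) x" if "i \<le> j" "x \<in> c" for j x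
    using s[OF s_le[OF that(2)]] s[OF order_trans[OF s_le[OF that(2)] that(1)]] by simp
  then show ?thesis
    by blast
qed

definition cofinal_below :: "'t :: order set \<Rightarrow> 't \<Rightarrow> bool" where
  "cofinal_below Z a \<longleftrightarrow> (\<forall>b<a. \<exists>z\<in>Z. b < z \<and> z < a)"

lemma cofinal_below_mono: "cofinal_below Z a \<Longrightarrow> Z \<subseteq> Z' \<Longrightarrow> cofinal_below Z' a"
  unfolding cofinal_below_def by blast

text \<open>\<open>a\<close> has cofinality \<open>k\<^sup>+\<close>, witnessed by \<open>c\<close>.\<close>
definition ladder :: "'k rel \<Rightarrow> 't :: order \<Rightarrow> 't set \<Rightarrow> bool" where
  "ladder k a c \<longleftrightarrow> c \<subseteq> {..<a} \<and> |c| \<le>o cardSuc k \<and> cofinal_below c a \<and>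
     (\<forall>Z. |Z| \<le>o k \<longrightarrow> \<not> cofinal_below Z a)"

lemma ladder_drop_to_large:
  assumes ladder: "ladder (card_of M) a c" and cofinal: "cofinal_below E a"
  shows "|M| <o |drop_to E ` c|"
proof -
  have "cofinal_below (drop_to E ` c) a"
    unfolding cofinal_below_def
  proof safe
    fix b assume "b < a"
    then obtain e where e: "e \<in> E" "b < e" "e < a"
      using cofinal unfolding cofinal_below_def by blast
    then obtain x where x: "x \<in> c" "e < x" "x < a"
      using ladder unfolding ladder_def cofinal_below_def by blast
    have "b < drop_to E x"
      using drop_to_greatest[OF e(1) less_imp_le[OF x(2)]] e(2) by (rule less_le_trans[rotated])
    moreover have "drop_to E x < a"
      using drop_to_le x(3) by (rule le_less_trans)
    ultimately show "\<exists>z\<in>drop_to E ` c. b < z \<and> z < a"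
      using x(1) by blast
  qed
  then show ?thesis
    using ladder unfolding ladder_def card_of_ordLess_iff_not_ordLeq by blast
qed

lemma ladder_range:
  fixes h :: "'m csuc \<Rightarrow> 't :: wellorder"
  assumes inf: "infinite (UNIV :: 'm set)" and mono: "strict_mono h" and bdd: "bdd_above (range h)"
  shows "ladder |UNIV :: 'm set| (lub (range h)) (range h)"
proof -
  define a where "a = lub (range h)"
  have h_less: "h i < a" for i
  proof -
    obtain j where "i < j"
      using ex_greater_csuc[OF inf] by blast
    then have "h i < h j"
      using mono by (simp add: strict_monoD)
    also have "h j \<le> a"
      unfolding a_def by (rule lub_upper[OF bdd]) simp
    finally show ?thesis .
  qed
  have less_h: "\<exists>i. b < h i" if "b < a" for b
    using less_lubD that unfolding a_def by blast
  have "\<not> cofinal_below Z a" if Z: "|Z| \<le>o |UNIV :: 'm set|" for Z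
  proof
    assume cof: "cofinal_below Z a"
    obtain g where g: "\<And>z. z < a \<Longrightarrow> z < h (g z)"
      using less_h by metis
    obtain k where k: "\<forall>i\<in>g ` Z. i < k"
      using csuc_bounded[OF inf card_of_image_ordLeq[OF Z]] by blast
    obtain z where "z \<in> Z" "h k < z" "z < a"
      using cof h_less unfolding cofinal_below_def by blast
    then have "h k < h (g z)"
      using g less_trans by blast
    then show False
      using k \<open>z \<in> Z\<close> mono by (auto simp: strict_mono_less)
  qed
  moreover have "|range h| \<le>o cardSuc |UNIV :: 'm set|"
    by (rule ordLeq_ordIso_trans[OF card_of_image card_of_UNIV_csuc])
  moreover have "cofinal_below (range h) a"
    using less_h h_less unfolding cofinal_below_def by blast
  ultimately show ?thesis
    unfolding ladder_def a_def[symmetric] using h_less by blast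
qed

lemma ex_strict_mono_into_club:
  fixes E :: "'u csuc set"
  assumes inf: "infinite (UNIV :: 'u set)" and card_le: "|UNIV :: 'i :: wellorder set| \<le>o |UNIV :: 'u set|"
    and club: "club E"
  shows "\<exists>h :: 'i \<Rightarrow> 'u csuc. strict_mono h \<and> range h \<subseteq> E"
proof -
  have "\<exists>h. \<forall>i :: 'i. h i \<in> E \<and> (\<forall>j<i. h j < h i)"
  proof (rule wellorder_dependent_choice)
    fix i and h :: "'i \<Rightarrow> 'u csuc"
    have "|h ` {..<i}| \<le>o |UNIV :: 'u set|"
      by (rule card_of_image_ordLeq[OF card_of_subset_ordLeq[OF subset_UNIV card_le]])
    then obtain b where "\<forall>z\<in>h ` {..<i}. z < b"
      using csuc_bounded[OF inf] by blast
    moreover obtain e where "e \<in> E" "b < e"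
      using club_unbounded[OF club] by blast
    ultimately show "\<exists>r. r \<in> E \<and> (\<forall>j<i. h j < r)"
      by (auto intro: less_trans)
  qed auto
  then show ?thesis
    by (auto intro!: strict_monoI)
qed

lemma ex_ladder_in_club:
  fixes E :: "'u csuc set"
  assumes inf: "infinite (UNIV :: 'm set)" and card_le: "|UNIV :: 'm csuc set| \<le>o |UNIV :: 'u set|"
    and club: "club E"
  shows "\<exists>a c. ladder |UNIV :: 'm set| a c \<and> cofinal_below E a"
proof -
  have inf_u: "infinite (UNIV :: 'u set)"
    using infinite_UNIV_csuc[OF inf] card_le by (rule card_of_ordLeq_infinite[rotated])
  obtain h :: "'m csuc \<Rightarrow> 'u csuc" where h: "strict_mono h" "range h \<subseteq> E"
    using ex_strict_mono_into_club[OF inf_u card_le club] by blast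
  have "bdd_above (range h)"
    by (rule csuc_bdd_above[OF inf_u card_of_image_ordLeq[OF card_le]])
  then have "ladder |UNIV :: 'm set| (lub (range h)) (range h)"
    by (rule ladder_range[OF inf h(1)])
  moreover from this have "cofinal_below E (lub (range h))"
    using cofinal_below_mono h(2) unfolding ladder_def by blast
  ultimately show ?thesis
    by blast
qed

lemma ex_decreasing_clubs:
  fixes F :: "'u csuc set \<Rightarrow> 'u csuc set"
  assumes inf: "infinite (UNIV :: 'u set)" and card_le: "|UNIV :: 'i :: wellorder set| \<le>o |UNIV :: 'u set|"
    and F: "\<And>E. club E \<Longrightarrow> club (F E)"
  shows "\<exists>G :: 'i \<Rightarrow> 'u csuc set. (\<forall>i. club (G i)) \<and> (\<forall>i j. i < j \<longrightarrow> G j \<subseteq> G i \<inter> F (G i))"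
proof -
  have "\<exists>G. \<forall>i :: 'i. club (G i) \<and> (\<forall>j<i. G i \<subseteq> G j \<inter> F (G j))"
  proof (rule wellorder_dependent_choice)
    fix i and G :: "'i \<Rightarrow> 'u csuc set"
    assume "\<And>j. j < i \<Longrightarrow> club (G j) \<and> (\<forall>l<j. G j \<subseteq> G l \<inter> F (G l))"
    then have "club (G j \<inter> F (G j))" if "j \<in> {..<i}" for j
      using that F club_Int[OF inf] by blast
    then have "club (\<Inter>j\<in>{..<i}. G j \<inter> F (G j))"
      by (rule club_INT[OF inf card_of_subset_ordLeq[OF subset_UNIV card_le]])
    then show "\<exists>r. club r \<and> (\<forall>j<i. r \<subseteq> G j \<inter> F (G j))"
      by blast
  qed auto
  then show ?thesis
    by blast
qed

lemma decreasing_clubs_drop_to_guess: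
  fixes G :: "'m csuc csuc \<Rightarrow> 'u csuc set"
  assumes inf: "infinite (UNIV :: 'm set)" and card_le: "|UNIV :: 'm csuc csuc set| \<le>o |UNIV :: 'u set|"
    and ladders: "\<And>a d. ladder |UNIV :: 'm set| a d \<Longrightarrow> ladder |UNIV :: 'm set| a (c a)"
    and club: "\<And>i. club (G i)" and decreasing: "\<And>i j. i < j \<Longrightarrow> G j \<subseteq> G i \<inter> F (G i)"
  shows "\<exists>i a. drop_to (G i) ` c a \<subseteq> F (G i) \<and> |UNIV :: 'm set| <o |drop_to (G i) ` c a|"
proof -
  note inf_suc = infinite_UNIV_csuc[OF inf]
  have inf_u: "infinite (UNIV :: 'u set)"
    using infinite_UNIV_csuc[OF inf_suc] card_le by (rule card_of_ordLeq_infinite[rotated])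
  have "antimono G"
  proof (rule antimonoI)
    show "G j \<subseteq> G i" if "i \<le> j" for i j
      using that decreasing[of i j] by (cases "i = j") auto
  qed
  have "|UNIV :: 'm csuc set| \<le>o |UNIV :: 'u set|"
    by (rule ordLeq_transitive[OF ordLess_imp_ordLeq[OF card_of_UNIV_ordLess_csuc] card_le])
  moreover have "club (\<Inter>i. G i)"
    by (rule club_INT[OF inf_u card_le club])
  ultimately obtain a d where "ladder |UNIV :: 'm set| a d" and cofinal: "cofinal_below (\<Inter>i. G i) a"
    using ex_ladder_in_club[OF inf] by blast
  then have ladder: "ladder |UNIV :: 'm set| a (c a)"
    using ladders by blast
  then have "|c a| \<le>o |UNIV :: 'm csuc set|"
    using ordLeq_ordIso_trans[OF _ ordIso_symmetric[OF card_of_UNIV_csuc]] unfolding ladder_def by blast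
  then obtain i where stable: "\<And>j x. i \<le> j \<Longrightarrow> x \<in> c a \<Longrightarrow> drop_to (G j) x = drop_to (G i) x"
    using drop_to_stabilises[OF inf_suc _ \<open>antimono G\<close>] by blast
  obtain j where "i < j"
    using ex_greater_csuc[OF inf_suc] by blast
  have "drop_to (G i) x \<in> F (G i)" if "x \<in> c a" for x
    using stable[OF less_imp_le[OF \<open>i < j\<close>] that] drop_to_mem[OF club, of j x] decreasing[OF \<open>i < j\<close>] by auto
  then have "drop_to (G i) ` c a \<subseteq> F (G i)"
    by blast
  moreover have "cofinal_below (G i) a"
    by (rule cofinal_below_mono[OF cofinal]) blast
  then have "|UNIV :: 'm set| <o |drop_to (G i) ` c a|"
    by (rule ladder_drop_to_large[OF ladder])
  ultimately show ?thesis
    by blast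
qed

text \<open>Otherwise choose a counterexample \<open>F E\<close> for every \<open>E\<close> and intersect these \<open>|'m|\<^sup>+\<^sup>+\<close> times: the
  stabilised values of \<open>drop_to\<close> then lie in the next counterexample.\<close>
lemma ex_drop_to_guessing:
  fixes c :: "'u csuc \<Rightarrow> 'u csuc set"
  assumes inf: "infinite (UNIV :: 'm set)" and card_le: "|UNIV :: 'm csuc csuc set| \<le>o |UNIV :: 'u set|"
    and ladders: "\<And>a d. ladder |UNIV :: 'm set| a d \<Longrightarrow> ladder |UNIV :: 'm set| a (c a)"
  shows "\<exists>E. \<forall>E'. club E' \<longrightarrow> (\<exists>a. drop_to E ` c a \<subseteq> E' \<and> |UNIV :: 'm set| <o |drop_to E ` c a| )"
proof (rule ccontr)
  have inf_u: "infinite (UNIV :: 'u set)"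
    using infinite_UNIV_csuc[OF infinite_UNIV_csuc[OF inf]] card_le by (rule card_of_ordLeq_infinite[rotated])
  assume "\<not> ?thesis"
  then have "\<forall>E. \<exists>E'. club E' \<and> (\<forall>a. drop_to E ` c a \<subseteq> E' \<longrightarrow> \<not> |UNIV :: 'm set| <o |drop_to E ` c a| )"
    by simp
  from choice[OF this] obtain F where
    "\<forall>E. club (F E) \<and> (\<forall>a. drop_to E ` c a \<subseteq> F E \<longrightarrow> \<not> |UNIV :: 'm set| <o |drop_to E ` c a| )" ..
  then have F: "club (F E)" "drop_to E ` c a \<subseteq> F E \<Longrightarrow> \<not> |UNIV :: 'm set| <o |drop_to E ` c a|" for E a
    by simp_all
  obtain G :: "'m csuc csuc \<Rightarrow> 'u csuc set"
    where G: "\<And>i. club (G i)" "\<And>i j. i < j \<Longrightarrow> G j \<subseteq> G i \<inter> F (G i)"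
    using ex_decreasing_clubs[OF inf_u card_le, of F] F(1) by blast
  have "\<exists>i a. drop_to (G i) ` c a \<subseteq> F (G i) \<and> |UNIV :: 'm set| <o |drop_to (G i) ` c a|"
    using inf card_le ladders G by (rule decreasing_clubs_drop_to_guess)
  then show False
    using F(2) by auto
qed

text \<open>Shelah's club guessing; the guesses live at points of cofinality \<open>|'m|\<^sup>+\<close>.\<close>
theorem club_guessing:
  assumes "infinite (UNIV :: 'm set)" "|UNIV :: 'm csuc csuc set| \<le>o |UNIV :: 'u set|"
  shows "\<exists>C :: 'u csuc \<Rightarrow> 'u csuc set. \<forall>E. club E \<longrightarrow> (\<exists>a. C a \<subseteq> E \<and> |UNIV :: 'm set| <o |C a| )"
proof -
  define c :: "'u csuc \<Rightarrow> 'u csuc set" where "c a = (SOME c. ladder |UNIV :: 'm set| a c)" for a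
  have "ladder |UNIV :: 'm set| a (c a)" if "ladder |UNIV :: 'm set| a d" for a d
    unfolding c_def using that by (rule someI)
  then have "\<exists>E. \<forall>E'. club E' \<longrightarrow> (\<exists>a. drop_to E ` c a \<subseteq> E' \<and> |UNIV :: 'm set| <o |drop_to E ` c a| )"
    by (rule ex_drop_to_guessing[OF assms])
  then show ?thesis
    by (elim exE) (rule exI)
qed

section \<open>Functions increasing along a filtration\<close>

lemma ex_unbounded_piece:
  fixes D :: "nat \<Rightarrow> 'u csuc set"
  assumes inf: "infinite (UNIV :: 'u set)" and cover: "(\<Union>n. D n) = UNIV"
  shows "\<exists>n. \<forall>k. \<exists>i\<in>D n. k < i"
proof (rule ccontr)
  assume "\<not> ?thesis"
  then have "\<forall>n. \<exists>k. \<forall>i\<in>D n. i \<le> k"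
    by (simp add: not_less)
  from choice[OF this] obtain k where k: "\<And>n i. i \<in> D n \<Longrightarrow> i \<le> k n"
    by blast
  obtain b where "\<forall>z\<in>range k. z < b"
    using csuc_bounded[OF inf card_of_countable_ordLeq[OF _ inf], of "range k"] by auto
  moreover obtain n where "b \<in> D n"
    using cover by blast
  ultimately show False
    using k[of b n] by (auto simp: not_less[symmetric])
qed

locale closed_filtration =
  fixes L :: "'a set" and B :: "'a csuc \<Rightarrow> nat \<Rightarrow> 'a csuc set"
  assumes infinite_L: "infinite L"
    and B_mono: "mono (B d)"
    and B_Union: "d \<in> below L \<Longrightarrow> (\<Union>n. B d n) = {..<d}"
    and B_closed: "d \<in> below L \<Longrightarrow> order_closure (B d n) \<inter> {..<d} \<subseteq> B d n"
begin

lemma club_sup_before_vimage: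
  fixes y :: "'u csuc \<Rightarrow> 'a csuc"
  assumes inf: "infinite (UNIV :: 'u set)" and d: "d \<in> below L"
    and less: "\<And>i. sup_before y i < y i" and y_less: "\<And>i. y i < d"
  shows "\<exists>n. club {i. sup_before y i \<in> B d n}"
proof -
  have bdd: "bdd_above (y ` Z)" for Z
    using y_less by (intro bdd_aboveI[of _ d]) (auto intro: less_imp_le)
  have x_less: "sup_before y i < d" for i
    using less y_less by (rule less_trans)
  have y_le_x: "y j \<le> sup_before y i" if "j < i" for i j
    unfolding sup_before_def using that by (intro lub_upper[OF bdd]) simp
  have x_mono: "sup_before y i \<le> sup_before y j" if "i \<le> j" for i j
    unfolding sup_before_def using that by (intro lub_mono[OF _ bdd] image_mono) auto
  define D where "D n = {i. sup_before y i \<in> B d n}" for n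
  have "(\<Union>n. D n) = UNIV"
    using x_less B_Union[OF d] unfolding D_def by blast
  then obtain n where n: "\<forall>k. \<exists>i\<in>D n. k < i"
    using ex_unbounded_piece[OF inf] by blast
  have "order_closure (D n) \<subseteq> D n"
  proof
    fix i assume i: "i \<in> order_closure (D n)"
    have "sup_before y i \<in> order_closure (B d n)"
      unfolding order_closure_def
    proof safe
      fix z assume "z < sup_before y i"
      then obtain j where j: "j < i" "z < y j"
        using less_lubD unfolding sup_before_def by blast
      then obtain e where e: "e \<in> D n" "j < e" "e \<le> i"
        using i unfolding order_closure_def by blast
      then show "\<exists>b\<in>B d n. z < b \<and> b \<le> sup_before y i"
        using less_le_trans[OF j(2) y_le_x[OF e(2)]] x_mono[OF e(3)] unfolding D_def by blast
    qed
    then show "i \<in> D n"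
      using B_closed[OF d] x_less unfolding D_def by blast
  qed
  then show ?thesis
    using n unfolding club_def D_def by blast
qed

end

locale increasing_along_filtration = closed_filtration +
  fixes f :: "'a csuc \<Rightarrow> nat \<Rightarrow> 'b :: order"
  assumes f_less: "d \<in> below L \<Longrightarrow> x \<in> B d n \<Longrightarrow> f x n < f d n"
begin

definition dominated :: "'a csuc set \<Rightarrow> 'a csuc \<Rightarrow> bool" where
  "dominated Z s \<longleftrightarrow> (\<forall>\<^sub>F n in sequentially. \<forall>z\<in>Z. f z n < f s n)"

lemma dominated_of_subset_filtration:
  assumes d: "d \<in> below L" and Z: "Z \<subseteq> B d n"
  shows "dominated Z d"
  unfolding dominated_def eventually_sequentially
  using f_less[OF d] Z monoD[OF B_mono] by (meson subsetD)

lemma eventually_less: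
  assumes "d \<in> below L" "x < d"
  shows "\<forall>\<^sub>F n in sequentially. f x n < f d n"
proof -
  obtain n where "{x} \<subseteq> B d n"
    using B_Union[OF assms(1)] assms(2) by blast
  then have "dominated {x} d"
    by (rule dominated_of_subset_filtration[OF assms(1)])
  then show ?thesis
    by (simp add: dominated_def)
qed

lemma eventually_le:
  assumes "d \<in> below L" "x \<le> d"
  shows "\<forall>\<^sub>F n in sequentially. f x n \<le> f d n"
proof (cases "x = d")
  case False
  then have "\<forall>\<^sub>F n in sequentially. f x n < f d n"
    using assms by (intro eventually_less) simp_all
  then show ?thesis
    by (rule eventually_mono) (rule less_imp_le)
qed simp

lemma dominated_less_trans:
  assumes "dominated Z s" "t \<in> below L" "s < t"
  shows "dominated Z t"
  using assms(1) eventually_less[OF assms(2,3)] unfolding dominated_def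
  by eventually_elim (auto intro: less_trans)

lemma inj_on_family: "inj_on f (below L)"
proof (rule linorder_inj_onI)
  show "f x \<noteq> f y" if less: "x < y" and y: "y \<in> below L" for x y
  proof -
    obtain n where "f x n < f y n"
      using eventually_less[OF y less] by (auto simp: eventually_sequentially)
    then show ?thesis
      by auto
  qed
qed auto

definition dominates_if_any :: "'a csuc set \<Rightarrow> 'a csuc \<Rightarrow> bool" where
  "dominates_if_any Z y \<longleftrightarrow> (\<forall>s\<in>below L. dominated Z s \<longrightarrow> dominated Z y)"

lemma ex_common_dominator:
  fixes Z :: "'i \<Rightarrow> 'a csuc set"
  assumes card_le: "|UNIV :: 'i set| \<le>o |L|" and x: "x \<in> below L"
    and Y: "Y \<subseteq> below L" "\<And>x. x \<in> below L \<Longrightarrow> \<exists>y\<in>Y. x < y"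
  shows "\<exists>y\<in>Y. x < y \<and> (\<forall>a. dominates_if_any (Z a) y)"
proof -
  have "\<forall>a. \<exists>s. s \<in> below L \<and> dominates_if_any (Z a) s"
    using x unfolding dominates_if_any_def by blast
  from choice[OF this] obtain s where s: "\<And>a. s a \<in> below L" "\<And>a. dominates_if_any (Z a) (s a)"
    by blast
  have "insert x (range s) \<subseteq> below L"
    using x s(1) by blast
  moreover have "|insert x (range s)| \<le>o |L|"
    by (rule card_of_insert_ordLeq_infinite[OF infinite_L card_of_image_ordLeq[OF card_le]])
  ultimately obtain b where b: "b \<in> below L" "\<forall>z\<in>insert x (range s). z < b"
    using below_bounded[OF infinite_L] by blast
  obtain y where y: "y \<in> Y" "b < y"
    using Y(2)[OF b(1)] by blast
  have "x < y" "s a < y" for a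
    using b(2) y(2) by (auto intro: less_trans)
  moreover have "y \<in> below L"
    using y(1) Y(1) by blast
  ultimately show ?thesis
    using y(1) s(2) dominated_less_trans unfolding dominates_if_any_def by blast
qed

lemma ex_dominating_sequence:
  fixes A :: "'i :: wellorder \<Rightarrow> 'i set"
  assumes card_le: "|UNIV :: 'i set| \<le>o |L|"
    and Y: "Y \<subseteq> below L" "\<And>x. x \<in> below L \<Longrightarrow> \<exists>y\<in>Y. x < y"
  shows "\<exists>y. \<forall>i. y i \<in> Y \<and> sup_before y i < y i \<and>
    (\<forall>a. dominates_if_any (sup_before y ` (A a \<inter> {..i})) (y i))"
proof (rule wellorder_dependent_choice)
  fix y y' :: "'i \<Rightarrow> 'a csuc" and i r
  assume "\<And>j. j < i \<Longrightarrow> y j = y' j"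
  then have eq: "sup_before y j = sup_before y' j" if "j \<le> i" for j
    using that by (intro sup_before_cong) auto
  then have "sup_before y ` (A a \<inter> {..i}) = sup_before y' ` (A a \<inter> {..i})" for a
    by (intro image_cong) auto
  then show "(r \<in> Y \<and> sup_before y i < r \<and> (\<forall>a. dominates_if_any (sup_before y ` (A a \<inter> {..i})) r)) \<longleftrightarrow>
      (r \<in> Y \<and> sup_before y' i < r \<and> (\<forall>a. dominates_if_any (sup_before y' ` (A a \<inter> {..i})) r))"
    using eq[OF order_refl] by (simp only:)
next
  fix y :: "'i \<Rightarrow> 'a csuc" and i
  assume "\<And>j. j < i \<Longrightarrow> y j \<in> Y \<and> sup_before y j < y j \<and>
    (\<forall>a. dominates_if_any (sup_before y ` (A a \<inter> {..j})) (y j))"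
  then have "y ` {..<i} \<subseteq> below L"
    using Y(1) by blast
  moreover have "|y ` {..<i}| \<le>o |L|"
    by (rule card_of_image_ordLeq[OF card_of_subset_ordLeq[OF subset_UNIV card_le]])
  ultimately obtain b where b: "b \<in> below L" "\<forall>z\<in>y ` {..<i}. z < b"
    using below_bounded[OF infinite_L] by blast
  then have "sup_before y i \<le> b"
    unfolding sup_before_def by (intro lub_least) (blast intro: less_imp_le)
  then have "sup_before y i \<in> below L"
    by (rule below_downward[OF b(1)])
  then show "\<exists>r. r \<in> Y \<and> sup_before y i < r \<and> (\<forall>a. dominates_if_any (sup_before y ` (A a \<inter> {..i})) r)"
    using ex_common_dominator[OF card_le _ Y, of _ "\<lambda>a. sup_before y ` (A a \<inter> {..i})"] by blast
qed

text \<open>The sequence \<open>y\<close> lies below some \<open>d\<close>, and a set \<open>B d n\<close> contains \<open>sup_before y i\<close> for a club of \<open>i\<close>. A guess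
  inside this club is dominated by \<open>d\<close>, hence, up to \<open>i\<close>, by \<open>y i\<close>.\<close>
lemma ex_large_dominated_set:
  assumes inf: "infinite (UNIV :: 'm set)" and card_le: "|UNIV :: 'm csuc csuc csuc set| \<le>o |L|"
    and Y: "Y \<subseteq> below L" "\<And>x. x \<in> below L \<Longrightarrow> \<exists>y\<in>Y. x < y"
  shows "\<exists>(y :: 'm csuc csuc csuc \<Rightarrow> 'a csuc) A. range y \<subseteq> Y \<and> bdd_above (range y) \<and>
    (\<forall>i. sup_before y i < y i) \<and> |UNIV :: 'm set| <o |A| \<and> (\<forall>i. dominated (sup_before y ` (A \<inter> {..i})) (y i))"
proof -
  note inf_suc = infinite_UNIV_csuc[OF infinite_UNIV_csuc[OF inf]]
  obtain C :: "'m csuc csuc csuc \<Rightarrow> 'm csuc csuc csuc set"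
    where C: "\<And>E. club E \<Longrightarrow> \<exists>a. C a \<subseteq> E \<and> |UNIV :: 'm set| <o |C a|"
    using club_guessing[OF inf ordLeq_refl[OF card_of_Card_order]] by blast
  obtain y where y: "\<And>i. y i \<in> Y" "\<And>i. sup_before y i < y i"
    and dom: "\<And>i a. dominates_if_any (sup_before y ` (C a \<inter> {..i})) (y i)"
    using ex_dominating_sequence[OF card_le Y, of C] by blast
  have "range y \<subseteq> below L"
    using y(1) Y(1) by blast
  then obtain d where d: "d \<in> below L" "\<forall>z\<in>range y. z < d"
    using below_bounded[OF infinite_L _ card_of_image_ordLeq[OF card_le]] by meson
  then have y_less: "y i < d" for i
    by blast
  obtain n where "club {i. sup_before y i \<in> B d n}"
    using club_sup_before_vimage[OF inf_suc d(1) y(2) y_less] by blast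
  then obtain a where a: "C a \<subseteq> {i. sup_before y i \<in> B d n}" "|UNIV :: 'm set| <o |C a|"
    using C by blast
  have "dominated (sup_before y ` (C a \<inter> {..i})) d" for i
    using a(1) by (intro dominated_of_subset_filtration[OF d(1), of _ n]) auto
  then have "dominated (sup_before y ` (C a \<inter> {..i})) (y i)" for i
    using dom d(1) unfolding dominates_if_any_def by blast
  moreover have "bdd_above (range y)"
    using y_less by (intro bdd_aboveI[of _ d]) (auto intro: less_imp_le)
  ultimately show ?thesis
    using y a(2) by blast
qed

lemma ex_domination_bound:
  fixes y :: "'i :: wellorder \<Rightarrow> 'a csuc"
  assumes y: "range y \<subseteq> below L" "bdd_above (range y)" "\<And>i. sup_before y i < y i"
    and dom: "dominated (sup_before y ` (A \<inter> {..i})) (y i)" and i: "i \<in> nonlast A"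
  shows "\<exists>n. (\<forall>j\<in>A \<inter> {..i}. f (sup_before y j) n < f (y i) n) \<and>
    f (y i) n \<le> f (sup_before y (next_in A i)) n"
proof -
  have "i < next_in A i"
    using i unfolding nonlast_def by (intro less_next_in) blast
  then have "y i \<le> sup_before y (next_in A i)"
    unfolding sup_before_def by (intro lub_upper bdd_above_mono[OF y(2)]) auto
  moreover have "sup_before y (next_in A i) \<in> below L"
    by (rule below_downward[OF subsetD[OF y(1) rangeI] less_imp_le[OF y(3)]])
  ultimately have "\<forall>\<^sub>F n in sequentially. f (y i) n \<le> f (sup_before y (next_in A i)) n"
    by (intro eventually_le)
  then have "\<forall>\<^sub>F n in sequentially. (\<forall>j\<in>A \<inter> {..i}. f (sup_before y j) n < f (y i) n) \<and>
      f (y i) n \<le> f (sup_before y (next_in A i)) n"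
    using dom unfolding dominated_def by eventually_elim simp
  then show ?thesis
    by (auto simp: eventually_sequentially)
qed

text \<open>Where the bound \<open>n\<close> of \<open>ex_domination_bound\<close> does not depend on \<open>i\<close>, \<open>f (y i) n\<close> increases with \<open>i\<close>.\<close>
lemma ex_large_coordinate_of_dominated:
  fixes y :: "'i :: wellorder \<Rightarrow> 'a csuc"
  assumes M: "infinite M" "|M| <o |A|"
    and y: "range y \<subseteq> below L" "bdd_above (range y)" "\<And>i. sup_before y i < y i"
    and dom: "\<And>i. dominated (sup_before y ` (A \<inter> {..i})) (y i)"
  shows "\<exists>n. |M| <o |(\<lambda>i. f (y i) n) ` A|"
proof -
  obtain k where k:
      "\<And>i j. i \<in> nonlast A \<Longrightarrow> j \<in> A \<Longrightarrow> j \<le> i \<Longrightarrow> f (sup_before y j) (k i) < f (y i) (k i)"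
      "\<And>i. i \<in> nonlast A \<Longrightarrow> f (y i) (k i) \<le> f (sup_before y (next_in A i)) (k i)"
    using ex_domination_bound[OF y dom] by (metis IntI atMost_iff)
  have "|M| <o |nonlast A|"
    using card_of_ordLeq_nonlast[OF M(1)] M(2) unfolding card_of_ordLess_iff_not_ordLeq by blast
  then obtain n where n: "|M| <o |{i \<in> nonlast A. k i = n}|"
    using ex_large_fibre[OF M(1)] by blast
  define U where "U = {i \<in> nonlast A. k i = n}"
  have "f (y i) n < f (y j) n" if i: "i \<in> U" and j: "j \<in> U" and "i < j" for i j
  proof -
    have "j \<in> A"
      using j by (simp add: U_def nonlast_def)
    then have "next_in A i \<in> A" "next_in A i \<le> j"
      using next_in_mem next_in_le \<open>i < j\<close> by blast+
    then have "f (sup_before y (next_in A i)) n < f (y j) n"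
      using k(1)[of j] j by (simp add: U_def)
    moreover have "f (y i) n \<le> f (sup_before y (next_in A i)) n"
      using k(2)[of i] i by (simp add: U_def)
    ultimately show ?thesis
      by (rule le_less_trans[rotated])
  qed
  then have "inj_on (\<lambda>i. f (y i) n) U"
    by (rule strict_mono_on_imp_inj_on[OF strict_mono_onI])
  then have "|U| \<le>o |(\<lambda>i. f (y i) n) ` A|"
    by (rule card_of_ordLeqI) (simp add: U_def nonlast_def)
  then have "|M| <o |(\<lambda>i. f (y i) n) ` A|"
    by (rule ordLess_ordLeq_trans[OF n[folded U_def]])
  then show ?thesis ..
qed

lemma ex_large_coordinate:
  assumes inf: "infinite (UNIV :: 'm set)" and card_le: "|UNIV :: 'm csuc csuc csuc set| \<le>o |L|"
    and Y: "Y \<subseteq> below L" "|L| <o |Y|"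
  shows "\<exists>n. |UNIV :: 'm set| <o |(\<lambda>y. f y n) ` Y|"
proof -
  have "\<exists>y\<in>Y. x < y" if "x \<in> below L" for x
    using infinite_L that Y(2) by (rule ex_greater_of_card_ordLess)
  then obtain y :: "'m csuc csuc csuc \<Rightarrow> 'a csuc" and A where y: "range y \<subseteq> Y" "bdd_above (range y)"
      "\<And>i. sup_before y i < y i"
    and A: "|UNIV :: 'm set| <o |A|" "\<And>i. dominated (sup_before y ` (A \<inter> {..i})) (y i)"
    using ex_large_dominated_set[OF inf card_le Y(1)] by blast
  obtain n where "|UNIV :: 'm set| <o |(\<lambda>i. f (y i) n) ` A|"
    using ex_large_coordinate_of_dominated[OF inf A(1) _ y(2,3) A(2)] y(1) Y(1) by blast
  moreover have "(\<lambda>i. f (y i) n) ` A \<subseteq> (\<lambda>y. f y n) ` Y"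
    using y(1) by blast
  ultimately show ?thesis
    using ordLess_ordLeq_trans[OF _ card_of_mono1] by blast
qed

lemma card_of_values_in_small_set:
  fixes q :: "nat \<Rightarrow> 'b \<Rightarrow> 'c"
  assumes inf: "infinite (UNIV :: 'm set)" and card_le: "|UNIV :: 'm csuc csuc csuc set| \<le>o |L|"
    and q: "\<And>n. inj_on (q n) ((\<lambda>x. f x n) ` below L)" and S: "|S| \<le>o |UNIV :: 'm set|"
  shows "|{x \<in> below L. \<forall>n. q n (f x n) \<in> S}| \<le>o |L|"
proof (rule ccontr)
  let ?Y = "{x \<in> below L. \<forall>n. q n (f x n) \<in> S}"
  assume "\<not> |?Y| \<le>o |L|"
  then obtain n where n: "|UNIV :: 'm set| <o |(\<lambda>y. f y n) ` ?Y|"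
    using ex_large_coordinate[OF inf card_le, of ?Y] unfolding card_of_ordLess_iff_not_ordLeq by blast
  have "inj_on (q n) ((\<lambda>y. f y n) ` ?Y)"
    using q by (rule inj_on_subset) blast
  then have "|(\<lambda>y. f y n) ` ?Y| \<le>o |S|"
    by (rule card_of_ordLeqI) blast
  then have "|(\<lambda>y. f y n) ` ?Y| \<le>o |UNIV :: 'm set|"
    using S by (rule ordLeq_transitive)
  then show False
    using n not_ordLess_ordLeq by blast
qed

end

section \<open>Sparse families of sequences\<close>

definition exhaustion :: "'a set \<Rightarrow> (nat \<Rightarrow> 'a set) \<Rightarrow> bool" where
  "exhaustion L A \<longleftrightarrow> mono A \<and> L \<subseteq> (\<Union>n. A n) \<and> (\<forall>n. infinite (A n) \<and> |A n| <o |L| )"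

lemma ex_exhaustion:
  fixes L :: "'a set"
  assumes nat: "|UNIV :: nat set| <o |L|" and K: "K \<subseteq> L" "cofinal K |L|" "countable K"
  shows "\<exists>A. exhaustion L A"
proof -
  have inf: "infinite L"
    by (rule iffD2[OF infinite_iff_card_of_nat ordLess_imp_ordLeq[OF nat]])
  obtain N :: "'a set" where N: "infinite N" "countable N"
    using infinite_countable_subset'[OF inf] by blast
  have "K \<noteq> {}"
    using K(2) inf unfolding cofinal_def by (auto simp: Field_card_of)
  then have range_K: "range (from_nat_into K) = K"
    using K(3) by (rule range_from_nat_into)
  define A where "A n = N \<union> (\<Union>i\<le>n. underS (card_of L) (from_nat_into K i))" for n
  have "|underS (card_of L) (from_nat_into K i)| <o |L|" for i
    using K(1) range_K by (intro card_of_underS card_of_Card_order) (auto simp: Field_card_of)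
  then have "|\<Union>i\<le>n. underS (card_of L) (from_nat_into K i)| <o |L|" for n
    by (intro card_of_finite_UN_ordLess[OF inf]) simp_all
  moreover have "|N| <o |L|"
    using N(2) nat unfolding countable_card_of_nat by (rule ordLeq_ordLess_trans)
  ultimately have "|A n| <o |L|" for n
    unfolding A_def by (intro card_of_Un_ordLess_infinite[OF inf])
  moreover have "infinite (A n)" for n
    using N(1) by (simp add: A_def)
  moreover have "mono A"
    unfolding A_def by (rule monoI) fastforce
  moreover have "L \<subseteq> (\<Union>n. A n)"
  proof
    fix x assume "x \<in> L"
    then obtain b where "b \<in> K" "x \<in> underS (card_of L) b"
      using K(2) unfolding cofinal_def underS_def by (auto simp: Field_card_of)
    moreover obtain n where "b = from_nat_into K n"
      using \<open>b \<in> K\<close> range_K by (metis rangeE)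
    ultimately have "x \<in> underS (card_of L) (from_nat_into K n)"
      by simp
    then show "x \<in> (\<Union>n. A n)"
      unfolding A_def by blast
  qed
  ultimately show ?thesis
    unfolding exhaustion_def by blast
qed

lemma closed_filtration_order_closure:
  fixes B :: "'a csuc \<Rightarrow> nat \<Rightarrow> 'a csuc set"
  assumes inf: "infinite L" and mono: "\<And>d. mono (B d)" and Union: "\<And>d. d \<in> below L \<Longrightarrow> (\<Union>n. B d n) = {..<d}"
  shows "closed_filtration L (\<lambda>d n. order_closure (B d n) \<inter> {..<d})"
proof
  show "infinite L"
    by (rule inf)
  show "mono (\<lambda>n. order_closure (B d n) \<inter> {..<d})" for d
    using monoD[OF mono] by (intro monoI Int_mono order_closure_mono order_refl)
  show "(\<Union>n. order_closure (B d n) \<inter> {..<d}) = {..<d}" if "d \<in> below L" for d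
    using Union[OF that] subset_order_closure by blast
  show "order_closure (order_closure (B d n) \<inter> {..<d}) \<inter> {..<d} \<subseteq> order_closure (B d n) \<inter> {..<d}" for d n
    using order_closure_mono[OF Int_lower1] order_closure_idem by blast
qed

lemma ex_closed_filtration:
  assumes inf: "infinite L" and A: "exhaustion L A"
  shows "\<exists>B. closed_filtration L B \<and> (\<forall>d\<in>below L. \<forall>n. |B d n| \<le>o |A n| )"
proof -
  have inf_A: "infinite (A n)" and mono_A: "mono A" and L_subset: "L \<subseteq> (\<Union>n. A n)" for n
    using A by (simp_all add: exhaustion_def)
  have "\<forall>d. \<exists>p. d \<in> below L \<longrightarrow> inj_on p {..<d} \<and> p ` {..<d} \<subseteq> L"
    by (simp add: below_def card_of_ordLeq)
  from choice[OF this] obtain p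
    where p: "\<And>d. d \<in> below L \<Longrightarrow> inj_on (p d) {..<d}" "\<And>d. d \<in> below L \<Longrightarrow> p d ` {..<d} \<subseteq> L"
    by blast
  define B where "B d n = {x \<in> {..<d}. p d x \<in> A n}" for d n
  have "mono (B d)" for d
    using monoD[OF mono_A] unfolding B_def by (intro monoI) blast
  moreover have "(\<Union>n. B d n) = {..<d}" if "d \<in> below L" for d
    using p(2)[OF that] L_subset unfolding B_def by blast
  ultimately have "closed_filtration L (\<lambda>d n. order_closure (B d n) \<inter> {..<d})"
    by (rule closed_filtration_order_closure[OF inf])
  moreover have "|order_closure (B d n) \<inter> {..<d}| \<le>o |A n|" if "d \<in> below L" for d n
  proof -
    have "inj_on (p d) (B d n)"
      by (rule inj_on_subset[OF p(1)[OF that]]) (auto simp: B_def)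
    then have "|B d n| \<le>o |A n|"
      by (rule card_of_ordLeqI) (simp add: B_def)
    then have "|order_closure (B d n)| \<le>o |A n|"
      by (rule card_of_order_closure[OF inf_A])
    then show ?thesis
      by (rule card_of_subset_ordLeq[OF Int_lower1])
  qed
  ultimately show ?thesis
    by blast
qed

lemma (in closed_filtration) ex_increasing_family:
  assumes A: "\<And>n. infinite (A n)" and B_card: "\<And>d n. d \<in> below L \<Longrightarrow> |B d n| \<le>o |A n|"
  shows "\<exists>f :: 'a csuc \<Rightarrow> nat \<Rightarrow> 'a csuc.
    increasing_along_filtration L B f \<and> (\<forall>d\<in>below L. \<forall>n. f d n \<in> below (A n))"
proof -
  have B_less: "x < d" if "d \<in> below L" "x \<in> B d n" for x d n
    using B_Union[OF that(1)] that(2) by blast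
  have "\<exists>f :: 'a csuc \<Rightarrow> nat \<Rightarrow> 'a csuc. \<forall>d.
      d \<in> below L \<longrightarrow> (\<forall>n. f d n \<in> below (A n) \<and> (\<forall>x\<in>B d n. f x n < f d n))"
  proof (rule wellorder_dependent_choice)
    fix f g :: "'a csuc \<Rightarrow> nat \<Rightarrow> 'a csuc" and d r
    assume "\<And>x. x < d \<Longrightarrow> f x = g x"
    then show "(d \<in> below L \<longrightarrow> (\<forall>n. r n \<in> below (A n) \<and> (\<forall>x\<in>B d n. f x n < r n))) \<longleftrightarrow>
        (d \<in> below L \<longrightarrow> (\<forall>n. r n \<in> below (A n) \<and> (\<forall>x\<in>B d n. g x n < r n)))"
      using B_less by simp
  next
    fix d and f :: "'a csuc \<Rightarrow> nat \<Rightarrow> 'a csuc"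
    assume prev: "\<And>x. x < d \<Longrightarrow> x \<in> below L \<longrightarrow> (\<forall>n. f x n \<in> below (A n) \<and> (\<forall>z\<in>B x n. f z n < f x n))"
    have "\<exists>b\<in>below (A n). \<forall>z\<in>(\<lambda>x. f x n) ` B d n. z < b" if d: "d \<in> below L" for n
    proof (rule below_bounded[OF A])
      show "(\<lambda>x. f x n) ` B d n \<subseteq> below (A n)"
        using prev B_less[OF d] below_downward[OF d] less_imp_le by blast
      show "|(\<lambda>x. f x n) ` B d n| \<le>o |A n|"
        by (rule card_of_image_ordLeq[OF B_card[OF d]])
    qed
    then have "d \<in> below L \<Longrightarrow> \<forall>n. \<exists>b. b \<in> below (A n) \<and> (\<forall>x\<in>B d n. f x n < b)"
      by blast
    then show "\<exists>r. d \<in> below L \<longrightarrow> (\<forall>n. r n \<in> below (A n) \<and> (\<forall>x\<in>B d n. f x n < r n))"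
      using choice[of "\<lambda>n b. b \<in> below (A n) \<and> (\<forall>x\<in>B d n. f x n < b)"] by blast
  qed
  then obtain f :: "'a csuc \<Rightarrow> nat \<Rightarrow> 'a csuc"
    where f: "\<forall>d. d \<in> below L \<longrightarrow> (\<forall>n. f d n \<in> below (A n) \<and> (\<forall>x\<in>B d n. f x n < f d n))" ..
  then have "increasing_along_filtration L B f"
    by unfold_locales blast
  then show ?thesis
    using f by blast
qed

definition sparse_family :: "'k rel \<Rightarrow> 'a set \<Rightarrow> (nat \<Rightarrow> 'a) set \<Rightarrow> bool" where
  "sparse_family k L X \<longleftrightarrow> (\<forall>f\<in>X. range f \<subseteq> L) \<and> |X| =o cardSuc |L| \<and>
     (\<forall>S. |S| \<le>o k \<longrightarrow> |{f \<in> X. range f \<subseteq> S}| \<le>o |L| )"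

lemma sparse_family_mono: "sparse_family k L X \<Longrightarrow> k' \<le>o k \<Longrightarrow> sparse_family k' L X"
  unfolding sparse_family_def using ordLeq_transitive by blast

lemma (in increasing_along_filtration) sparse_family_encoding:
  fixes q :: "nat \<Rightarrow> 'b \<Rightarrow> 'a"
  assumes inf: "infinite (UNIV :: 'm set)" and card_le: "|UNIV :: 'm csuc csuc csuc set| \<le>o |L|"
    and inj: "\<And>n. inj_on (q n) ((\<lambda>x. f x n) ` below L)" and mem_L: "\<And>x n. x \<in> below L \<Longrightarrow> q n (f x n) \<in> L"
  shows "sparse_family |UNIV :: 'm set| L ((\<lambda>x n. q n (f x n)) ` below L)"
  unfolding sparse_family_def
proof (intro conjI allI impI)
  define g where "g = (\<lambda>x n. q n (f x n))"
  show "\<forall>h\<in>(\<lambda>x n. q n (f x n)) ` below L. range h \<subseteq> L"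
    using mem_L by blast
  have "inj_on g (below L)"
  proof (rule inj_onI)
    fix x y assume xy: "x \<in> below L" "y \<in> below L" "g x = g y"
    have "q n (f x n) = q n (f y n)" for n
      using fun_cong[OF xy(3), of n] by (simp add: g_def)
    then have "f x n = f y n" for n
      using inj xy by (auto dest: inj_onD)
    then show "x = y"
      using inj_on_family xy by (auto dest: inj_onD)
  qed
  then have "|below L| =o |g ` below L|"
    by (rule card_of_ordIsoI[OF inj_on_imp_bij_betw])
  then show "|(\<lambda>x n. q n (f x n)) ` below L| =o cardSuc |L|"
    using ordIso_transitive[OF ordIso_symmetric card_of_below[OF infinite_L]] unfolding g_def by blast
  fix S :: "'a set" assume S: "|S| \<le>o |UNIV :: 'm set|"
  have "{h \<in> g ` below L. range h \<subseteq> S} \<subseteq> g ` {x \<in> below L. \<forall>n. q n (f x n) \<in> S}"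
    unfolding g_def by blast
  then show "|{h \<in> (\<lambda>x n. q n (f x n)) ` below L. range h \<subseteq> S}| \<le>o |L|"
    unfolding g_def by (rule card_of_subset_ordLeq[OF _ ordLeq_transitive[OF card_of_image
      card_of_values_in_small_set[OF inf card_le inj S]]])
qed

lemma ex_sparse_family:
  assumes inf: "infinite (UNIV :: 'm set)" and card_le: "|UNIV :: 'm csuc csuc csuc set| \<le>o |L|"
    and A: "exhaustion L A"
  shows "\<exists>X. sparse_family |UNIV :: 'm set| L X"
proof -
  have inf_L: "infinite L"
    using infinite_UNIV_csuc[OF infinite_UNIV_csuc[OF infinite_UNIV_csuc[OF inf]]] card_le
    by (rule card_of_ordLeq_infinite[rotated])
  have inf_A: "infinite (A n)" and A_less: "|A n| <o |L|" for n
    using A by (simp_all add: exhaustion_def)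
  obtain B where "closed_filtration L B" and B: "\<forall>d\<in>below L. \<forall>n. |B d n| \<le>o |A n|"
    using ex_closed_filtration[OF inf_L A] by blast
  then obtain f :: "'a csuc \<Rightarrow> nat \<Rightarrow> 'a csuc"
    where "increasing_along_filtration L B f" and f_below: "\<And>d n. d \<in> below L \<Longrightarrow> f d n \<in> below (A n)"
    using closed_filtration.ex_increasing_family[of L B A] inf_A by blast
  then interpret increasing_along_filtration L B f
    by blast
  have "|below (A n)| \<le>o |L|" for n
    using A_less by (intro ordIso_ordLeq_trans[OF card_of_below[OF inf_A]] cardSuc_least card_of_Card_order)
  then have "\<forall>n. \<exists>q. inj_on q (below (A n)) \<and> q ` below (A n) \<subseteq> L"
    by (simp add: card_of_ordLeq)
  from choice[OF this] obtain q where q: "\<And>n. inj_on (q n) (below (A n))" "\<And>n. q n ` below (A n) \<subseteq> L"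
    by blast
  have "inj_on (q n) ((\<lambda>x. f x n) ` below L)" for n
    by (rule inj_on_subset[OF q(1)]) (use f_below in blast)
  moreover have "q n (f x n) \<in> L" if "x \<in> below L" for x n
    using q(2) f_below[OF that] by blast
  ultimately have "sparse_family |UNIV :: 'm set| L ((\<lambda>x n. q n (f x n)) ` below L)"
    by (rule sparse_family_encoding[OF inf card_le])
  then show ?thesis ..
qed

text \<open>Adding the constant sequences makes every element of \<open>L\<close> an entry of a sequence in the family.\<close>
lemma sparse_family_Un_constants:
  assumes inf: "infinite L" and X: "sparse_family k L X"
  shows "sparse_family k L (X \<union> (\<lambda>l _. l) ` L)"
  unfolding sparse_family_def
proof (intro conjI allI impI)
  let ?K = "(\<lambda>l _ :: nat. l) ` L"
  show "\<forall>f\<in>X \<union> ?K. range f \<subseteq> L"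
    using X unfolding sparse_family_def by auto
  have card_X: "|X| =o cardSuc |L|"
    using X by (simp add: sparse_family_def)
  have "|L| \<le>o |X|"
    using cardSuc_ordLeq[OF card_of_Card_order] ordIso_symmetric[OF card_X] by (rule ordLeq_ordIso_trans)
  then have "|X \<union> ?K| \<le>o |X|"
    using inf card_of_ordLeq_finite
    by (intro card_of_Un_ordLeq_infinite card_of_image_ordLeq ordLeq_refl card_of_Card_order) blast+
  then have "|X \<union> ?K| =o |X|"
    unfolding ordIso_iff_ordLeq by (simp add: card_of_mono1)
  then show "|X \<union> ?K| =o cardSuc |L|"
    using card_X by (rule ordIso_transitive)
  fix S :: "'a set" assume "|S| \<le>o k"
  then have "|{f \<in> X. range f \<subseteq> S}| \<le>o |L|"
    using X by (simp add: sparse_family_def)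
  then have "|{f \<in> X. range f \<subseteq> S} \<union> ?K| \<le>o |L|"
    by (intro card_of_Un_ordLeq_infinite[OF inf] card_of_image)
  moreover have "{f \<in> X \<union> ?K. range f \<subseteq> S} \<subseteq> {f \<in> X. range f \<subseteq> S} \<union> ?K"
    by blast
  ultimately show "|{f \<in> X \<union> ?K. range f \<subseteq> S}| \<le>o |L|"
    using card_of_subset_ordLeq by blast
qed

section \<open>The graph of initial segments\<close>

definition initial_segments :: "(nat \<Rightarrow> 'a) set \<Rightarrow> 'a list set" where
  "initial_segments X = {map f [0..<n] | f n. f \<in> X}"

definition prefix_graph :: "(nat \<Rightarrow> 'a) set \<Rightarrow> ('a list \<times> (nat \<Rightarrow> 'a)) set" where
  "prefix_graph X = {(xs, f). f \<in> X \<and> xs = map f [0..<length xs]}"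

lemma type_T_graph_prefix_graph:
  assumes "\<forall>f\<in>X. range f \<subseteq> L" "|X| =o k"
  shows "type_T_graph L k (initial_segments X) X (prefix_graph X)"
proof -
  define T where "T = down_closure X"
  define E where "E = {(s, t). s \<in> T \<and> t \<in> T \<and> s \<noteq> t \<and> comparable s t}"
  have "tree_with_tops L k X T"
    using assms by (simp add: tree_with_tops_def T_def)
  moreover have "T_graph T E"
  proof -
    have "tless s t \<Longrightarrow> s \<noteq> t" for s t :: "'a tnode"
      by (auto simp: tless_def split: sum.splits)
    then show ?thesis
      unfolding T_graph_def E_def by (auto simp: sym_def comparable_def)
  qed
  moreover have "initial_segments X = {xs. Inl xs \<in> T}"
    unfolding initial_segments_def T_def down_closure_def by auto
  moreover have "prefix_graph X = {(xs, f). (Inl xs, Inr f) \<in> E}"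
    unfolding prefix_graph_def E_def T_def down_closure_def by (auto simp: comparable_def tless_def)
  ultimately show ?thesis
    unfolding type_T_graph_def by blast
qed

lemma card_of_initial_segments:
  assumes inf: "infinite L" and X: "\<forall>f\<in>X. range f \<subseteq> L" and constants: "(\<lambda>l _. l) ` L \<subseteq> X"
  shows "|initial_segments X| =o |L|"
proof -
  have "initial_segments X \<subseteq> lists L"
    using X unfolding initial_segments_def by (fastforce simp: image_subset_iff)
  then have "|initial_segments X| \<le>o |L|"
    using card_of_lists_ordLeq_infinite[OF inf] by (rule card_of_subset_ordLeq)
  moreover have "[l] \<in> initial_segments X" if "l \<in> L" for l
  proof -
    have "[l] = map (\<lambda>_. l) [0..<1]" "(\<lambda>_. l) \<in> X"
      using that constants by auto
    then show ?thesis
      unfolding initial_segments_def by (intro CollectI exI conjI)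
  qed
  then have "|L| \<le>o |initial_segments X|"
    by (intro card_of_ordLeqI[of "\<lambda>l. [l]"]) (auto simp: inj_on_def)
  ultimately show ?thesis
    by (simp add: ordIso_iff_ordLeq)
qed

lemma lk_graph_prefix_graph:
  assumes "|initial_segments X| =o lam" "|X| =o k"
  shows "lk_graph lam k (initial_segments X) X (prefix_graph X)"
proof -
  have "infinite {a \<in> initial_segments X. (a, f) \<in> prefix_graph X}" if "f \<in> X" for f
  proof -
    have "inj (\<lambda>n. map f [0..<n])"
      by (rule injI) (metis diff_zero length_map length_upt)
    then have "infinite (range (\<lambda>n. map f [0..<n]))"
      by (rule range_inj_infinite)
    moreover have "range (\<lambda>n. map f [0..<n]) \<subseteq> {a \<in> initial_segments X. (a, f) \<in> prefix_graph X}"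
      using that unfolding initial_segments_def prefix_graph_def by auto
    ultimately show ?thesis
      using finite_subset by blast
  qed
  moreover have "prefix_graph X \<subseteq> initial_segments X \<times> X"
    unfolding initial_segments_def prefix_graph_def by blast
  ultimately show ?thesis
    using assms unfolding lk_graph_def by blast
qed

lemma range_subset_of_infinite_prefixes:
  assumes "infinite {a \<in> C. a = map h [0..<length a]}"
  shows "range h \<subseteq> (\<Union>a\<in>C. set a)"
proof safe
  fix n
  have "\<exists>a\<in>C. a = map h [0..<length a] \<and> n < length a"
  proof (rule ccontr)
    assume "\<not> ?thesis"
    then have "{a \<in> C. a = map h [0..<length a]} \<subseteq> (\<lambda>k. map h [0..<k]) ` {..n}"
      by (auto simp: not_less)
    then show False
      using assms finite_subset by blast
  qed
  then obtain a where a: "a \<in> C" "a = map h [0..<length a]" "n < length a"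
    by blast
  have "h n = a ! n"
    by (subst a(2)) (simp add: a(3))
  then show "h n \<in> (\<Union>a\<in>C. set a)"
    using a(1,3) nth_mem by auto
qed

lemma not_has_subgraph_prefix_graph:
  assumes X: "sparse_family natLeq L X"
  shows "\<not> has_subgraph natLeq (cardSuc |L| ) (initial_segments X) X (prefix_graph X)"
proof
  assume "has_subgraph natLeq (cardSuc |L| ) (initial_segments X) X (prefix_graph X)"
  then obtain C D F where sub: "D \<subseteq> X" "F \<subseteq> prefix_graph X" and C: "|C| =o natLeq" and D: "|D| =o cardSuc |L|"
    and nb: "\<And>f. f \<in> D \<Longrightarrow> infinite {a \<in> C. (a, f) \<in> F}"
    unfolding has_subgraph_def lk_graph_def by auto
  define S where "S = (\<Union>a\<in>C. set a)"
  have "countable C"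
    using C unfolding countable_card_le_natLeq by (rule ordIso_imp_ordLeq)
  then have "countable S"
    unfolding S_def by (auto intro: countable_finite)
  then have "|{f \<in> X. range f \<subseteq> S}| \<le>o |L|"
    using X unfolding sparse_family_def countable_card_le_natLeq by blast
  moreover have "D \<subseteq> {f \<in> X. range f \<subseteq> S}"
  proof
    fix f assume f: "f \<in> D"
    have "{a \<in> C. (a, f) \<in> F} \<subseteq> {a \<in> C. a = map f [0..<length a]}"
      using sub(2) unfolding prefix_graph_def by auto
    then have "infinite {a \<in> C. a = map f [0..<length a]}"
      using nb[OF f] finite_subset by blast
    then show "f \<in> {f \<in> X. range f \<subseteq> S}"
      using range_subset_of_infinite_prefixes f sub(1) unfolding S_def by blast
  qed
  ultimately have "|D| \<le>o |L|"
    by (rule card_of_subset_ordLeq[rotated])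
  moreover have "|L| <o |D|"
    using card_of_ordLess_cardSuc ordIso_symmetric[OF D] by (rule ordLess_ordIso_trans)
  ultimately show False
    using not_ordLess_ordLeq by blast
qed

section \<open>Singular cardinals\<close>

lemma regularCard_ordLess_singular:
  assumes "Cinfinite r" "regularCard r" "r \<le>o |L|" "\<not> regularCard |L|"
  shows "r <o |L|"
  using assms(3) regularCard_ordIso[OF _ assms(1,2)] assms(4)
  unfolding ordLeq_iff_ordLess_or_ordIso by auto

lemma nat_ordLess_singular:
  assumes "infinite L" "\<not> regularCard |L|"
  shows "|UNIV :: nat set| <o |L|"
proof -
  have "natLeq \<le>o |L|"
    using assms(1) infinite_iff_natLeq_ordLeq by blast
  then have "natLeq <o |L|"
    using assms(2) by (rule regularCard_ordLess_singular[OF natLeq_Cinfinite regularCard_natLeq])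
  then show ?thesis
    by (rule ordIso_ordLess_trans[OF card_of_nat])
qed

lemma csuc_ordLess_singular:
  assumes "infinite (UNIV :: 'a set)" "|UNIV :: 'a set| <o |L|" "\<not> regularCard |L|"
  shows "|UNIV :: 'a csuc set| <o |L|"
proof -
  have "Cinfinite |UNIV :: 'a set|"
    using assms(1) by (simp add: cinfinite_def Field_card_of card_of_card_order_on)
  then have "Cinfinite (cardSuc |UNIV :: 'a set| )" "regularCard (cardSuc |UNIV :: 'a set| )"
    by (rule Cinfinite_cardSuc, rule regularCard_cardSuc)
  moreover have "cardSuc |UNIV :: 'a set| \<le>o |L|"
    by (intro cardSuc_least card_of_Card_order assms(2))
  ultimately have "cardSuc |UNIV :: 'a set| <o |L|"
    using assms(3) by (rule regularCard_ordLess_singular)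
  then show ?thesis
    by (rule ordIso_ordLess_trans[OF card_of_UNIV_csuc])
qed

theorem theorem7p1:
  fixes L :: "'a set"
  assumes "infinite L"
    and "\<not> regularCard (card_of L)"
    and "\<exists>K. K \<subseteq> L \<and> cofinal K (card_of L) \<and> countable K"
  shows "\<exists>A B H. type_T_graph L (cardSuc (card_of L)) A B H \<and>
                 lk_graph (card_of L) (cardSuc (card_of L)) A B H \<and>
                 \<not> has_subgraph natLeq (cardSuc (card_of L)) A B H"
proof -
  have nat: "|UNIV :: nat set| <o |L|"
    by (rule nat_ordLess_singular[OF assms(1,2)])
  have "|UNIV :: nat csuc csuc csuc set| \<le>o |L|"
    by (intro ordLess_imp_ordLeq csuc_ordLess_singular infinite_UNIV_csuc infinite_UNIV_nat nat assms(2))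
  moreover obtain A where "exhaustion L A"
    using ex_exhaustion[OF nat] assms(3) by blast
  ultimately obtain Y where Y: "sparse_family |UNIV :: nat set| L Y"
    using ex_sparse_family[OF infinite_UNIV_nat] by blast
  define X where "X = Y \<union> (\<lambda>l _. l) ` L"
  have X: "sparse_family natLeq L X"
    unfolding X_def using sparse_family_mono[OF Y ordIso_imp_ordLeq[OF ordIso_symmetric[OF card_of_nat]]]
    by (rule sparse_family_Un_constants[OF assms(1)])
  then have ranges: "\<forall>f\<in>X. range f \<subseteq> L" and card_X: "|X| =o cardSuc |L|"
    by (simp_all add: sparse_family_def)
  have "|initial_segments X| =o |L|"
    by (rule card_of_initial_segments[OF assms(1) ranges]) (simp add: X_def)
  then have "lk_graph (card_of L) (cardSuc |L| ) (initial_segments X) X (prefix_graph X)"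
    using card_X by (rule lk_graph_prefix_graph)
  then show ?thesis
    using type_T_graph_prefix_graph[OF ranges card_X] not_has_subgraph_prefix_graph[OF X] by blast
qed

end
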